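(* Let $(\mathcal G\cup\mathcal I,<)$ be a countable linearly ordered set such that the sets $\mathcal G$ and $\mathcal I$ are disjoint. If $\mathcal G$ interlaces $\mathcal I$, and the smallest and the largest elements of $\mathcal G\cup\mathcal I$ exist and belong to $\mathcal G$, then there exist a compact subset $Y\subset\mathbb R$ and an increasing bijection $F\colon\mathcal G\cup\mathcal I\to\mathcal Q_Y$ such that $F[\mathcal G]=\mathcal G_Y$ and $F[\mathcal I]=\mathcal I_Y$.
   Context: For subsets $\mathcal G,\mathcal B$ of a linearly ordered set $(\mathcal Q,<)$, we say that $\mathcal G$ interlaces $\mathcal B$ if for every two elements $I<J$ of $\mathcal B$ there is $K\in\mathcal G$ with $I<K<J$. For a compact set $Y\subset\mathbb R$: a $Y$-gap is a connected component of $\mathbb R\setminus Y$ (unbounded components included), and a $Y$-interval is a non-trivial (more than one point) connected component of $Y$. $\mathcal G_Y$ is the family of all $Y$-gaps, $\mathcal I_Y$ the family of all $Y$-intervals, and $\mathcal Q_Y=\mathcal G_Y\cup\mathcal I_Y$, linearly ordered by: for distinct $I,J\in\mathcal Q_Y$, $I<J$ if and only if $\sup I\leqslant\inf J$. *)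

theory Defs
  imports "HOL-Analysis.Analysis"
begin

text \<open>Linearly ordered sets are given by their strict order relation, as in
  \<^const>\<open>strict_linear_order_on\<close>.\<close>

definition interlaces :: "'a rel \<Rightarrow> 'a set \<Rightarrow> 'a set \<Rightarrow> bool" where
  "interlaces r G B \<longleftrightarrow>
    (\<forall>I\<in>B. \<forall>J\<in>B. (I, J) \<in> r \<longrightarrow> (\<exists>K\<in>G. (I, K) \<in> r \<and> (K, J) \<in> r))"

definition gaps :: "real set \<Rightarrow> real set set" where
  "gaps Y = components (- Y)"

definition intervals :: "real set \<Rightarrow> real set set" where
  "intervals Y = {C \<in> components Y. \<exists>x\<in>C. \<exists>y\<in>C. x \<noteq> y}"

definition pieces :: "real set \<Rightarrow> real set set" where
  "pieces Y = gaps Y \<union> intervals Y"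

text \<open>Suprema and infima are taken in the extended reals, because the \<^term>\<open>Sup\<close> and
  \<^term>\<open>Inf\<close> of \<^typ>\<open>real\<close> are unspecified on the unbounded gaps.\<close>

definition pieces_order :: "real set \<Rightarrow> (real set) rel" where
  "pieces_order Y = {(I, J). I \<in> pieces Y \<and> J \<in> pieces Y \<and> I \<noteq> J \<and>
     (SUP x\<in>I. ereal x) \<le> (INF y\<in>J. ereal y)}"

lemma pieces_nontrivial:
  assumes "compact Y" "C \<in> pieces Y"
  shows "\<exists>x\<in>C. \<exists>y\<in>C. x < y"
proof (cases "C \<in> gaps Y")
  case True
  then have C: "C \<in> components (- Y)" by (simp add: gaps_def)
  have "open (- Y)" using assms(1) by (simp add: compact_imp_closed open_Compl)
  then have "open C" using C open_components by blast
  moreover obtain x where "x \<in> C" using C in_components_nonempty by blast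
  ultimately obtain e where e: "e > 0" "ball x e \<subseteq> C" by (meson open_contains_ball)
  then have "x + e / 2 \<in> C" by (auto simp: dist_real_def)
  moreover have "x < x + e / 2" using e(1) by simp
  ultimately show ?thesis using \<open>x \<in> C\<close> by blast
next
  case False
  then obtain x y where xy: "x \<in> C" "y \<in> C" "x \<noteq> y"
    using assms(2) by (auto simp: pieces_def intervals_def)
  then have "x < y \<or> y < x" by linarith
  then show ?thesis using xy by blast
qed

lemma pieces_disjoint:
  assumes "I \<in> pieces Y" "J \<in> pieces Y" "I \<noteq> J"
  shows "I \<inter> J = {}"
proof -
  have "I \<in> components Y \<or> I \<in> components (- Y)" "J \<in> components Y \<or> J \<in> components (- Y)"
    using assms by (auto simp: pieces_def gaps_def intervals_def)
  then show ?thesis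
  proof (elim disjE)
    assume "I \<in> components Y" "J \<in> components Y"
    then show ?thesis using assms(3) by (simp add: components_nonoverlap)
  next
    assume "I \<in> components (- Y)" "J \<in> components (- Y)"
    then show ?thesis using assms(3) by (simp add: components_nonoverlap)
  qed (auto dest!: in_components_subset)
qed

lemma pieces_connected: "I \<in> pieces Y \<Longrightarrow> connected I"
  by (auto simp: pieces_def gaps_def intervals_def in_components_connected)

lemma strict_linear_order_on_pieces:
  assumes "compact Y"
  shows "strict_linear_order_on (pieces Y) (pieces_order Y)"
proof -
  have pt: "(I, J) \<in> pieces_order Y \<longleftrightarrow>
      I \<in> pieces Y \<and> J \<in> pieces Y \<and> I \<noteq> J \<and> (\<forall>x\<in>I. \<forall>y\<in>J. x \<le> y)" for I J
    by (auto simp: pieces_order_def SUP_le_iff le_INF_iff)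
  have "trans (pieces_order Y)"
  proof (rule transI)
    fix I J K assume a: "(I, J) \<in> pieces_order Y" "(J, K) \<in> pieces_order Y"
    obtain x y where xy: "x \<in> J" "y \<in> J" "x < y"
      using pieces_nontrivial[OF assms] a pt by blast
    have lt: "u < v" if "u \<in> I" "v \<in> K" for u v
    proof -
      have "u \<le> x" "y \<le> v" using a xy that unfolding pt by auto
      then show ?thesis using xy by linarith
    qed
    obtain z where "z \<in> I" using pieces_nontrivial[OF assms] a pt by blast
    then have "I \<noteq> K" using lt[of z z] by auto
    then show "(I, K) \<in> pieces_order Y"
      using a lt unfolding pt by (auto intro: less_imp_le)
  qed
  moreover have "irrefl (pieces_order Y)" by (auto simp: irrefl_def pieces_order_def)
  moreover have "total_on (pieces Y) (pieces_order Y)"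
  proof (rule total_onI)
    fix I J assume IJ: "I \<in> pieces Y" "J \<in> pieces Y" "I \<noteq> J"
    have d: "I \<inter> J = {}" using pieces_disjoint IJ by blast
    note ivl = connectedD_interval[OF pieces_connected[OF IJ(1)]]
      connectedD_interval[OF pieces_connected[OF IJ(2)]]
    have "(\<forall>x\<in>I. \<forall>y\<in>J. x \<le> y) \<or> (\<forall>x\<in>J. \<forall>y\<in>I. x \<le> y)"
    proof (rule ccontr)
      assume "\<not> ?thesis"
      then obtain x y u v where o: "x \<in> I" "y \<in> J" "y < x" "u \<in> J" "v \<in> I" "v < u"
        by (auto simp: not_le)
      show False
      proof (cases "y \<le> v")
        case True
        then show False using ivl(2)[of y u v] o d by auto
      next
        case False
        then show False using ivl(1)[of v x y] o d by auto
      qed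
    qed
    then show "(I, J) \<in> pieces_order Y \<or> (J, I) \<in> pieces_order Y"
      using IJ unfolding pt by blast
  qed
  ultimately show ?thesis by (simp add: strict_linear_order_on_def)
qed

end

theory Submission
  imports Defs
begin

text \<open>Remove the least element \<open>a\<close> and the greatest element \<open>b\<close>, give the remaining elements
  positive weights with a finite sum \<open>W\<close>, and lay them out as consecutive intervals of these lengths
  in \<open>[0, W]\<close>. Removing from \<open>[0, W]\<close> the open intervals of the elements of \<open>\<G>\<close> gives \<open>Y\<close>; the
  elements \<open>a\<close> and \<open>b\<close> become the unbounded gaps. Since the lengths add up to \<open>W\<close>, every
  non-degenerate subinterval of \<open>[0, W]\<close> overlaps the interval of some element. Hence every
  non-trivial component of \<open>Y\<close> overlaps the interval of an element of \<open>\<I>\<close>, and by interlacing it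
  cannot be larger than that interval.\<close>

text \<open>The elements are lined up by accumulated weight: \<open>lo x\<close> is the total weight
  of what lies below \<open>x\<close>, and \<open>hi x\<close> adds the weight of \<open>x\<close>
  itself. The last property says that these intervals leave no hole of positive length, even when
  the order is dense.\<close>

lemma countable_linear_order_layout:
  fixes S :: "'a set"
  assumes "countable S" and lin: "strict_linear_order_on S r"
  obtains lo hi :: "'a \<Rightarrow> real" and W :: real where
    "0 \<le> W"
    "\<And>x. x \<in> S \<Longrightarrow> 0 \<le> lo x" "\<And>x. x \<in> S \<Longrightarrow> lo x < hi x" "\<And>x. x \<in> S \<Longrightarrow> hi x \<le> W"
    "\<And>x y. x \<in> S \<Longrightarrow> y \<in> S \<Longrightarrow> (x, y) \<in> r \<Longrightarrow> hi x \<le> lo y"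
    "\<And>p q. 0 \<le> p \<Longrightarrow> p < q \<Longrightarrow> q \<le> W \<Longrightarrow> \<exists>y\<in>S. lo y < q \<and> p < hi y"
proof -
  have tr: "trans r" and irr: "irrefl r" and tot: "total_on S r"
    using lin by (auto simp: strict_linear_order_on_def)
  \<comment> \<open>\<open>to_nat_on S\<close> is injective on the countable set \<open>S\<close>,
    so the weights are distinct terms of the geometric series and are summable whether
    \<open>S\<close> is finite or infinite.\<close>
  define w :: "'a \<Rightarrow> real" where "w x = (1 / 2) ^ to_nat_on S x" for x
  have pos: "0 < w x" for x by (simp add: w_def)
  have "(\<lambda>n. (1 / 2 :: real) ^ n) summable_on UNIV"
    by (subst summable_on_UNIV_nonneg_real_iff) auto
  then have "(\<lambda>n. (1 / 2 :: real) ^ n) summable_on to_nat_on S ` S"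
    by (rule summable_on_subset_banach) simp
  then have "w summable_on S"
    using summable_on_reindex[OF inj_on_to_nat_on[OF \<open>countable S\<close>], of "\<lambda>n. (1 / 2 :: real) ^ n"]
    by (simp add: w_def[abs_def] o_def)
  then have summ: "w summable_on A" if "A \<subseteq> S" for A
    using summable_on_subset_banach that by blast
  have mono: "infsum w A \<le> infsum w B" if "A \<subseteq> B" "B \<subseteq> S" for A B
    using that by (intro infsum_mono2 summ) (auto intro: less_imp_le[OF pos])
  have fin: "sum w T \<le> infsum w A" if "finite T" "T \<subseteq> A" "A \<subseteq> S" for A T
    using that by (intro finite_sum_le_infsum summ) (auto intro: less_imp_le[OF pos])
  have split: "infsum w S = infsum w A + infsum w (S - A)" if "A \<subseteq> S" for A
    using infsum_Un_disjoint[OF summ[OF that] summ[of "S - A"]] that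
    by (simp add: Un_absorb1 Diff_Int_distrib)
  define W where "W = infsum w S"
  define below where "below x = {y \<in> S. (y, x) \<in> r}" for x
  define lo where "lo x = infsum w (below x)" for x
  define hi where "hi x = infsum w (insert x (below x))" for x
  have sub: "below x \<subseteq> S" for x by (auto simp: below_def)
  have hi: "hi x = w x + lo x" for x
    unfolding hi_def lo_def by (rule infsum_insert[OF summ[OF sub]])
      (use irr in \<open>auto simp: below_def irrefl_def\<close>)
  have lohi: "lo x < hi x" for x using hi[of x] pos[of x] by simp
  have nonneg: "0 \<le> infsum w A" for A by (intro infsum_nonneg less_imp_le[OF pos])
  have hilo: "hi x \<le> lo y" if "x \<in> S" "(x, y) \<in> r" for x y
    unfolding hi_def lo_def
    by (rule mono) (use that transD[OF tr] in \<open>auto simp: below_def\<close>)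
  have hiW: "hi x \<le> W" if "x \<in> S" for x
    unfolding hi_def W_def by (rule mono) (use that sub in auto)
  \<comment> \<open>If no element overlaps \<open>{p<..<q}\<close>, every interval lies left of
    \<open>p\<close> or right of \<open>q\<close>. The first kind has total weight at most
    \<open>p\<close>, the second at most \<open>W - q\<close>, and together this is less than
    \<open>W\<close>.\<close>
  have cover: "\<exists>y\<in>S. lo y < q \<and> p < hi y" if pq: "0 \<le> p" "p < q" "q \<le> W" for p q
  proof (rule ccontr)
    assume "\<not> ?thesis"
    then have neg: "q \<le> lo y \<or> hi y \<le> p" if "y \<in> S" for y using that by force
    define A where "A = {y \<in> S. hi y \<le> p}"
    have AS: "A \<subseteq> S" by (auto simp: A_def)
    have "infsum w A \<le> p"
    proof (rule infsum_le_finite_sums[OF summ[OF AS]])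
      fix T assume T: "finite T" "T \<subseteq> A"
      show "sum w T \<le> p"
      proof (cases "T = {}")
        case False
        \<comment> \<open>The element \<open>m\<close> attaining the maximum is the last one of
          \<open>T\<close>, so \<open>T\<close> is contained in \<open>insert m (below m)\<close>,
          whose weight is \<open>hi m\<close>.\<close>
        then have "Max (hi ` T) \<in> hi ` T" using T by simp
        then obtain m where m: "m \<in> T" "hi m = Max (hi ` T)" by auto
        have "y = m \<or> (y, m) \<in> r" if "y \<in> T" for y
        proof (rule ccontr)
          assume "\<not> ?thesis"
          then have "(m, y) \<in> r" using tot that m T AS by (auto simp: total_on_def)
          then have "hi m \<le> lo y" using hilo m T AS by blast
          moreover have "hi y \<le> hi m" using m that T by simp
          ultimately show False using lohi[of y] by simp
        qed
        then have "sum w T \<le> hi m"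
          unfolding hi_def using T AS m sub by (intro fin) (auto simp: below_def)
        also have "\<dots> \<le> p" using m T by (auto simp: A_def)
        finally show ?thesis .
      qed (use pq in simp)
    qed
    moreover have "infsum w (S - A) \<le> W - q"
    proof (rule infsum_le_finite_sums[OF summ])
      fix T assume T: "finite T" "T \<subseteq> S - A"
      show "sum w T \<le> W - q"
      proof (cases "T = {}")
        case False
        \<comment> \<open>Dually, \<open>m\<close> is now the first element of \<open>T\<close>, so
          \<open>T\<close> avoids \<open>below m\<close>, whose weight \<open>lo m\<close> is at
          least \<open>q\<close> because \<open>m\<close> is not in \<open>A\<close>.\<close>
        then have "Min (lo ` T) \<in> lo ` T" using T by simp
        then obtain m where m: "m \<in> T" "lo m = Min (lo ` T)" by auto
        have "(y, m) \<notin> r" if "y \<in> T" for y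
        proof
          assume "(y, m) \<in> r"
          then have "hi y \<le> lo m" using hilo that T by blast
          moreover have "lo m \<le> lo y" using m that T by simp
          ultimately show False using lohi[of y] by simp
        qed
        then have "sum w T \<le> infsum w (S - below m)"
          using T by (intro fin) (auto simp: below_def)
        also have "\<dots> = W - lo m" using split[OF sub[of m]] by (simp add: W_def lo_def)
        also have "\<dots> \<le> W - q" using neg[of m] m T by (auto simp: A_def)
        finally show ?thesis .
      qed (use pq in simp)
    qed auto
    ultimately show False using split[OF AS] pq by (simp add: W_def)
  qed
  show thesis
    using that[of W lo hi] nonneg lohi hiW hilo cover by (simp add: W_def lo_def)
qed

text \<open>A piece has two distinct points, so the weak pointwise comparison already excludes
  \<open>I = J\<close>.\<close>

lemma less_imp_pieces_order:
  assumes "compact Y" "I \<in> pieces Y" "J \<in> pieces Y" "\<And>x y. x \<in> I \<Longrightarrow> y \<in> J \<Longrightarrow> x \<le> y"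
  shows "(I, J) \<in> pieces_order Y"
proof -
  obtain x y where "x \<in> I" "y \<in> I" "x < y" using pieces_nontrivial[OF assms(1,2)] by blast
  then have "I \<noteq> J" using assms(4)[of y x] by auto
  then show ?thesis using assms by (auto simp: pieces_order_def SUP_le_iff le_INF_iff)
qed

theorem theorem1:
  fixes \<G> \<I> :: "'a set" and r :: "'a rel"
  assumes "countable (\<G> \<union> \<I>)"
    and "strict_linear_order_on (\<G> \<union> \<I>) r"
    and "\<G> \<inter> \<I> = {}"
    and "interlaces r \<G> \<I>"
    and "\<exists>a\<in>\<G>. \<forall>x\<in>\<G> \<union> \<I>. x \<noteq> a \<longrightarrow> (a, x) \<in> r"
    and "\<exists>b\<in>\<G>. \<forall>x\<in>\<G> \<union> \<I>. x \<noteq> b \<longrightarrow> (x, b) \<in> r"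
  shows "\<exists>(Y :: real set) F. compact Y \<and>
    bij_betw F (\<G> \<union> \<I>) (pieces Y) \<and>
    monotone_on (\<G> \<union> \<I>) (\<lambda>x y. (x, y) \<in> r) (\<lambda>x y. (x, y) \<in> pieces_order Y) F \<and>
    F ` \<G> = gaps Y \<and> F ` \<I> = intervals Y"
proof -
  have tr: "trans r" and irr: "irrefl r" and tot: "total_on (\<G> \<union> \<I>) r"
    using assms(2) by (auto simp: strict_linear_order_on_def)
  have nrefl: "(x, x) \<notin> r" for x using irr by (simp add: irrefl_def)
  have asym: "(y, x) \<notin> r" if "(x, y) \<in> r" for x y using that tr nrefl transD by metis
  obtain a where a: "a \<in> \<G>" "\<And>x. x \<in> \<G> \<union> \<I> \<Longrightarrow> x \<noteq> a \<Longrightarrow> (a, x) \<in> r" using assms(5) by blast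
  obtain b where b: "b \<in> \<G>" "\<And>x. x \<in> \<G> \<union> \<I> \<Longrightarrow> x \<noteq> b \<Longrightarrow> (x, b) \<in> r" using assms(6) by blast
  have least: "(x, a) \<notin> r" and greatest: "(b, x) \<notin> r" if "x \<in> \<G> \<union> \<I>" for x
    using a(2)[OF that] b(2)[OF that] asym nrefl by blast+
  show ?thesis
  proof (cases "a = b")
    \<comment> \<open>There is only one element; the empty set works, its sole gap being the whole
      line.\<close>
    case True
    then have "x = a" if "x \<in> \<G> \<union> \<I>" for x using a(2)[OF that] b(2)[OF that] asym by blast
    then have G: "\<G> = {a}" and I: "\<I> = {}" using a(1) assms(3) by auto
    have "gaps {} = {UNIV}"
      unfolding gaps_def by (simp add: components_eq_sing_iff)
    moreover have "intervals {} = {}" by (simp add: intervals_def)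
    ultimately show ?thesis
      using nrefl unfolding G I
      by (intro exI[of _ "{}"] exI[of _ "\<lambda>_. UNIV"])
        (auto simp: pieces_def monotone_on_def bij_betw_def)
  next
    case ab: False

    \<comment> \<open>Construction of the compact set\<close>
    define S where "S = (\<G> \<union> \<I>) - {a, b}"
    have linS: "strict_linear_order_on S r"
      using tr irr tot by (auto simp: strict_linear_order_on_def total_on_def S_def)
    have "countable S" using assms(1) by (simp add: S_def)
    obtain lo hi W where W: "0 \<le> W"
      and lo0: "\<And>x. x \<in> S \<Longrightarrow> (0::real) \<le> lo x" and lohi: "\<And>x. x \<in> S \<Longrightarrow> lo x < hi x"
      and hiW: "\<And>x. x \<in> S \<Longrightarrow> hi x \<le> W"
      and hilo: "\<And>x y. x \<in> S \<Longrightarrow> y \<in> S \<Longrightarrow> (x, y) \<in> r \<Longrightarrow> hi x \<le> lo y"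
      and cover: "\<And>p q. 0 \<le> p \<Longrightarrow> p < q \<Longrightarrow> q \<le> W \<Longrightarrow> \<exists>y\<in>S. lo y < q \<and> p < hi y"
      by (rule countable_linear_order_layout[OF \<open>countable S\<close> linS]) blast
    \<comment> \<open>Gaps of a compact set are open and its components are closed, which dictates
      the endpoints. If \<open>S\<close> is empty, \<open>cover\<close> forces \<open>W = 0\<close>,
      and \<open>Y\<close> below is the single point 0.\<close>
    define F where "F x = (if x = a then {..<0} else if x = b then {W<..}
      else if x \<in> \<G> then {lo x<..<hi x} else {lo x..hi x})" for x
    define Y where "Y = - \<Union> (F ` \<G>)"
    have IS: "\<I> \<subseteq> S" using a(1) b(1) assms(3) by (auto simp: S_def)
    have SI: "x \<in> \<I>" if "x \<in> S" "x \<notin> \<G>" for x using that by (auto simp: S_def)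
    have FS: "F x = {lo x<..<hi x}" if "x \<in> S" "x \<in> \<G>" for x using that by (auto simp: F_def S_def)
    have FI: "F x = {lo x..hi x}" if "x \<in> \<I>" for x
      using that IS assms(3) by (auto simp: F_def S_def)
    have FSsub: "F x \<subseteq> {lo x..hi x}" if "x \<in> S" for x
      using FS[OF that] FI SI[OF that] by (cases "x \<in> \<G>") auto
    have tri: "x = a \<or> x = b \<or> x \<in> S" if "x \<in> \<G> \<union> \<I>" for x using that by (auto simp: S_def)
    have Fa: "F a = {..<0}" and Fb: "F b = {W<..}" using ab by (auto simp: F_def)
    have Fle: "u \<le> v" if xy: "x \<in> \<G> \<union> \<I>" "y \<in> \<G> \<union> \<I>" "(x, y) \<in> r" and uv: "u \<in> F x" "v \<in> F y"
      for x y u v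
    proof -
      have "y \<noteq> a" "x \<noteq> b" using xy least greatest by blast+
      consider "x = a" "y = b" | "x = a" "y \<in> S" | "x \<in> S" "y = b" | "x \<in> S" "y \<in> S"
        using tri[OF xy(1)] tri[OF xy(2)] \<open>y \<noteq> a\<close> \<open>x \<noteq> b\<close> by blast
      then show ?thesis
      proof cases
        case 1 then show ?thesis using uv Fa Fb W by auto
      next
        case 2 then show ?thesis using uv Fa FSsub[of y] lo0[of y] by fastforce
      next
        case 3 then show ?thesis using uv Fb FSsub[of x] hiW[of x] by fastforce
      next
        case 4 then show ?thesis using uv FSsub[of x] FSsub[of y] hilo[of x y] xy by fastforce
      qed
    qed
    have cmp: "(x, y) \<in> r \<or> (y, x) \<in> r" if "x \<in> \<G> \<union> \<I>" "y \<in> \<G> \<union> \<I>" "x \<noteq> y" for x y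
      using tot that by (auto simp: total_on_def)
    \<comment> \<open>\<open>Fle\<close> alone would allow a common point \<open>u\<close>. But
      \<open>F x\<close> is open, so \<open>u\<close> can be moved inside \<open>F x\<close> by
      \<open>e / 2\<close> towards the side of \<open>F y\<close>, which violates
      \<open>Fle\<close>.\<close>
    have Fdisj: "F x \<inter> F y = {}" if "x \<in> \<G>" "y \<in> \<G> \<union> \<I>" "x \<noteq> y" for x y
    proof (rule ccontr)
      have xy: "(x, y) \<in> r \<or> (y, x) \<in> r" using cmp that by blast
      have "open (F x)" using that(1) by (auto simp: F_def)
      assume "F x \<inter> F y \<noteq> {}"
      then obtain u where u: "u \<in> F x" "u \<in> F y" by blast
      obtain e where e: "e > 0" "ball u e \<subseteq> F x" using \<open>open (F x)\<close> u by (meson open_contains_ball)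
      have "u + e / 2 \<in> F x" "u - e / 2 \<in> F x" using e by (auto intro!: subsetD[OF e(2)] simp: dist_real_def)
      then show False using that Fle[of x y "u + e / 2" u] Fle[of y x u "u - e / 2"] u e xy by auto
    qed
    have Y0W: "Y \<subseteq> {0..W}"
    proof
      fix u assume "u \<in> Y"
      then have "u \<notin> F a" "u \<notin> F b" using a(1) b(1) by (auto simp: Y_def)
      then show "u \<in> {0..W}" by (auto simp: Fa Fb)
    qed
    have op: "open (F x)" "connected (F x)" "F x \<noteq> {}" if xG: "x \<in> \<G>" for x
    proof -
      consider "x = a" | "x = b" | "x \<in> S" using tri[of x] xG by blast
      then have "open (F x) \<and> connected (F x) \<and> F x \<noteq> {}"
        by cases (use lohi[of x] in \<open>auto simp: Fa Fb FS xG intro: gt_ex lt_ex\<close>)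
      then show "open (F x)" "connected (F x)" "F x \<noteq> {}" by auto
    qed
    have "compact Y"
      unfolding compact_eq_bounded_closed
      using bounded_subset[OF bounded_closed_interval Y0W] op(1)
      by (auto simp: Y_def intro!: closed_Compl open_UN)

    \<comment> \<open>The gaps\<close>
    have gaps: "F ` \<G> = gaps Y"
    proof -
      \<comment> \<open>A pairwise disjoint family of nonempty connected open sets consists exactly
        of the components of its union, here \<open>- Y\<close>.\<close>
      have "disjnt (F x) (F y)" if "x \<in> \<G>" "y \<in> \<G>" "F x \<noteq> F y" for x y
        using Fdisj[of x y] that by (cases "x = y") (simp_all add: disjnt_def)
      then have "pairwise disjnt (F ` \<G>)" by (auto simp: pairwise_def)
      then show ?thesis
        unfolding gaps_def by (intro components_open_unique[symmetric]) (auto simp: Y_def op)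
    qed
    have IY: "F x \<subseteq> Y" if "x \<in> \<I>" for x
    proof -
      have "F z \<inter> F x = {}" if "z \<in> \<G>" for z
        using that \<open>x \<in> \<I>\<close> assms(3) by (intro Fdisj) auto
      then show ?thesis by (auto simp: Y_def)
    qed

    \<comment> \<open>The non-trivial components\<close>
    have meets: "\<exists>y\<in>\<I>. lo y < q \<and> p < hi y" if pq: "p < q" "{p..q} \<subseteq> Y" for p q
    proof -
      have "p \<in> Y" "q \<in> Y" using pq by auto
      then have "0 \<le> p" "q \<le> W" using Y0W by auto
      then obtain y where y: "y \<in> S" "lo y < q" "p < hi y" using cover pq(1) by blast
      \<comment> \<open>Otherwise the overlap of \<open>{p<..<q}\<close> with the open interval of
        \<open>y\<close> would contain a point lying both in \<open>Y\<close> and in a gap.\<close>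
      have "y \<notin> \<G>"
      proof
        assume "y \<in> \<G>"
        obtain u where u: "max p (lo y) < u" "u < min q (hi y)"
          using dense[of "max p (lo y)" "min q (hi y)"] y pq(1) lohi[OF y(1)] by auto
        then have "u \<in> F y" using FS y \<open>y \<in> \<G>\<close> by auto
        moreover have "u \<in> Y" using u pq by auto
        ultimately show False using \<open>y \<in> \<G>\<close> by (auto simp: Y_def)
      qed
      then show ?thesis using y SI by blast
    qed
    \<comment> \<open>Two intervals of \<open>\<I>\<close> cannot both meet a connected part of \<open>Y\<close>, since a gap lies between them.\<close>
    have uniq: "x = y" if xy: "x \<in> \<I>" "y \<in> \<I>" and pq: "{p..q} \<subseteq> Y" "lo x < q" "p < hi x" "lo y < q" "p < hi y"
      for x y p q
    proof -
      have no: False if o: "x \<in> \<I>" "y \<in> \<I>" "(x, y) \<in> r" "lo y < q" "p < hi x" for x y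
      proof -
        obtain z where z: "z \<in> \<G>" "(x, z) \<in> r" "(z, y) \<in> r"
          using assms(4) o by (auto simp: interlaces_def)
        have "z \<in> S" using z o least[of x] greatest[of y] by (auto simp: S_def)
        then have "hi x \<le> lo z" "hi z \<le> lo y" using hilo z o IS by auto
        \<comment> \<open>The chain \<open>p < hi x \<le> lo z < u < hi z \<le> lo y < q\<close>
          puts \<open>u\<close> into \<open>{p..q}\<close>, hence into \<open>Y\<close>.\<close>
        moreover obtain u where u: "lo z < u" "u < hi z" using dense lohi[OF \<open>z \<in> S\<close>] by blast
        ultimately have "u \<in> Y" using pq o by auto
        moreover have "u \<in> F z" using FS z \<open>z \<in> S\<close> u by auto
        ultimately show False using z by (auto simp: Y_def)
      qed
      show ?thesis
        using no[of x y] no[of y x] xy pq cmp[of x y] by blast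
    qed
    \<comment> \<open>This is the maximality of \<open>F x\<close> among connected subsets of
      \<open>Y\<close>. If \<open>C\<close> reached a point \<open>u\<close> beyond an end of
      \<open>F x\<close>, then \<open>meets\<close> would give some \<open>y\<close> overlapping the
      excess part, and \<open>uniq\<close>, applied to the stretch from \<open>u\<close> to the far
      end of \<open>F x\<close>, would give \<open>y = x\<close>, although \<open>F x\<close> stops
      before that part.\<close>
    have grow: "C \<subseteq> F x" if "x \<in> \<I>" and C: "connected C" "C \<subseteq> Y" "F x \<subseteq> C" for x C
    proof
      fix u assume "u \<in> C"
      have xS: "lo x < hi x" and Fx: "F x = {lo x..hi x}" using lohi IS FI that(1) by auto
      have ends: "lo x \<in> C" "hi x \<in> C" using C(3) xS unfolding Fx by auto
      have "\<not> u < lo x"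
      proof
        assume lt: "u < lo x"
        then obtain y where "y \<in> \<I>" "lo y < lo x" "u < hi y"
          using meets[of u "lo x"] connected_contains_Icc[OF C(1) \<open>u \<in> C\<close> ends(1)] C(2) by blast
        moreover have "{u..hi x} \<subseteq> Y"
          using connected_contains_Icc[OF C(1) \<open>u \<in> C\<close> ends(2)] C(2) by blast
        ultimately show False using uniq[of x y u "hi x"] that(1) xS lt by auto
      qed
      moreover have "\<not> hi x < u"
      proof
        assume lt: "hi x < u"
        then obtain y where "y \<in> \<I>" "lo y < u" "hi x < hi y"
          using meets[of "hi x" u] connected_contains_Icc[OF C(1) ends(2) \<open>u \<in> C\<close>] C(2) by blast
        moreover have "{lo x..u} \<subseteq> Y"
          using connected_contains_Icc[OF C(1) ends(1) \<open>u \<in> C\<close>] C(2) by blast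
        ultimately show False using uniq[of x y "lo x" u] that(1) xS lt by auto
      qed
      ultimately show "u \<in> F x" by (simp add: Fx)
    qed
    have comp: "F x \<in> components Y" if "x \<in> \<I>" for x
      using grow[OF that] IY[OF that] FI[OF that] lohi[of x] that IS
      by (fastforce simp: in_components_maximal)
    have ivls: "F ` \<I> = intervals Y"
    proof (intro subset_antisym subsetI)
      fix C assume "C \<in> F ` \<I>"
      then obtain x where x: "x \<in> \<I>" "C = F x" by blast
      have "lo x \<in> F x" "hi x \<in> F x" "lo x \<noteq> hi x" using FI[OF x(1)] lohi[of x] x(1) IS by auto
      then show "C \<in> intervals Y" using comp x by (auto simp: intervals_def)
    next
      fix C assume "C \<in> intervals Y"
      then obtain p' q' where C: "C \<in> components Y" and "p' \<in> C" "q' \<in> C" "p' \<noteq> q'"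
        by (auto simp: intervals_def)
      then obtain p q where pq: "p \<in> C" "q \<in> C" "p < q" by (metis linorder_neqE)
      have CY: "C \<subseteq> Y" using C by (rule in_components_subset)
      have "{p..q} \<subseteq> C" using connected_contains_Icc in_components_connected[OF C] pq by blast
      then obtain y where y: "y \<in> \<I>" "lo y < q" "p < hi y" using meets[OF pq(3)] CY by blast
      \<comment> \<open>This is the left end of the overlap of the two intervals; components sharing
        a point coincide.\<close>
      have "max p (lo y) \<in> F y \<inter> {p..q}" using y FI[OF y(1)] lohi[of y] IS pq by auto
      then have "C \<inter> F y \<noteq> {}" using \<open>{p..q} \<subseteq> C\<close> by blast
      then have "C = F y" using components_nonoverlap[OF C comp[OF y(1)]] by blast
      then show "C \<in> F ` \<I>" using y by blast
    qed

    \<comment> \<open>The increasing bijection\<close>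
    have img: "F ` (\<G> \<union> \<I>) = pieces Y" using gaps ivls by (simp add: pieces_def image_Un)
    have mon: "(F x, F y) \<in> pieces_order Y" if "x \<in> \<G> \<union> \<I>" "y \<in> \<G> \<union> \<I>" "(x, y) \<in> r" for x y
      by (rule less_imp_pieces_order[OF \<open>compact Y\<close>]) (use that img Fle in blast)+
    \<comment> \<open>Distinct elements are comparable, so by \<open>mon\<close> their images are
      related by the irreflexive \<open>pieces_order Y\<close>.\<close>
    have "inj_on F (\<G> \<union> \<I>)"
    proof (rule inj_onI, rule ccontr)
      fix x y assume xy: "x \<in> \<G> \<union> \<I>" "y \<in> \<G> \<union> \<I>" "F x = F y" "x \<noteq> y"
      then have "(F x, F y) \<in> pieces_order Y \<or> (F y, F x) \<in> pieces_order Y"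
        using mon cmp[of x y] by blast
      then show False using xy by (simp add: pieces_order_def)
    qed
    then show ?thesis
      using \<open>compact Y\<close> img mon gaps ivls
      by (intro exI[of _ Y] exI[of _ F]) (auto simp: bij_betw_def monotone_on_def)
  qed
qed

end
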